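(* Let $K\leq \mathrm{Aut}(Q_n)$ and let $\ell$ be a positive integer. The following are equivalent: (i) $(Q_n)_K$ is regular of valency $n$ with $a_{i-1}=0$ and $c_i=i$ for $1\leq i\leq \ell$; (ii) $d_K\geq 2\ell+1$.
   Context: The $n$-cube $Q_n$ has vertex set $\mathbb{F}_2^n$, two vectors adjacent iff their Hamming distance is $1$; $\mathrm{Aut}(Q_n)=\mathbb{F}_2^n: S_n$ (translations and coordinate permutations). For $K\leq\mathrm{Aut}(Q_n)$, $d_K:=\min\{d_{Q_n}(x,x^k): x\in\mathbb{F}_2^n,\ 1\neq k\in K\}$ if $K\neq 1$ and $d_K:=\infty$ if $K=1$. The normal quotient $(Q_n)_K$ is the simple graph whose vertices are the $K$-orbits $x^K$ on $\mathbb{F}_2^n$, distinct orbits adjacent iff some vertex of one is adjacent in $Q_n$ to some vertex of the other. For a graph $\Pi$, a vertex $u$ and $i\geq 0$, $\Pi_i(u)$ is the set of vertices at distance $i$ from $u$ and $\Pi(u)=\Pi_1(u)$. For $u,v$ with $d_\Pi(u,v)=i$, $c_i(u,v):=|\Pi_{i-1}(u)\cap\Pi(v)|$ and $a_i(u,v):=|\Pi_i(u)\cap\Pi(v)|$; writing "$c_i=c$" (resp. "$a_i=a$") means $c_i(u,v)=c$ (resp. $a_i(u,v)=a$) for all pairs $u,v$ at distance $i$. *)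

theory Defs
  imports "HOL-Algebra.Group_Action" "HOL-Library.Z2" "HOL-Library.Extended_Nat" "HOL-Library.FuncSet"
begin

section \<open>Simple graphs\<close>

record 'a sgraph =
  verts :: "'a set"
  adj :: "'a rel"

locale simple_graph =
  fixes G :: "'a sgraph"
  assumes adj_verts: "adj G \<subseteq> verts G \<times> verts G"
    and adj_sym: "sym (adj G)"
    and adj_irrefl: "irrefl (adj G)"

text \<open>A pair in the \<open>k\<close>-th relational power of adjacency is a pair joined by a walk of length \<open>k\<close>.
  The infimum of the empty set in \<^typ>\<open>enat\<close> is \<open>\<infinity>\<close>, the distance between different components.\<close>

definition gdist :: "'a sgraph \<Rightarrow> 'a \<Rightarrow> 'a \<Rightarrow> enat" where
  "gdist G u v = (INF k \<in> {k. (u, v) \<in> adj G ^^ k}. enat k)"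

definition sphere_at :: "'a sgraph \<Rightarrow> nat \<Rightarrow> 'a \<Rightarrow> 'a set" where
  "sphere_at G i u = {v \<in> verts G. gdist G u v = enat i}"

definition regular_of_valency :: "'a sgraph \<Rightarrow> nat \<Rightarrow> bool" where
  "regular_of_valency G k \<longleftrightarrow>
     (\<forall>u \<in> verts G. finite (sphere_at G 1 u) \<and> card (sphere_at G 1 u) = k)"

text \<open>\<open>c_number\<close> is meant for \<open>i \<ge> 1\<close> only, since \<open>i - 1\<close> is truncated at \<open>0\<close>.\<close>

definition c_number :: "'a sgraph \<Rightarrow> nat \<Rightarrow> 'a \<Rightarrow> 'a \<Rightarrow> nat" where
  "c_number G i u v = card (sphere_at G (i - 1) u \<inter> sphere_at G 1 v)"

definition a_number :: "'a sgraph \<Rightarrow> nat \<Rightarrow> 'a \<Rightarrow> 'a \<Rightarrow> nat" where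
  "a_number G i u v = card (sphere_at G i u \<inter> sphere_at G 1 v)"

definition c_equals :: "'a sgraph \<Rightarrow> nat \<Rightarrow> nat \<Rightarrow> bool" where
  "c_equals G i c \<longleftrightarrow>
     (\<forall>u \<in> verts G. \<forall>v \<in> verts G. gdist G u v = enat i \<longrightarrow> c_number G i u v = c)"

definition a_equals :: "'a sgraph \<Rightarrow> nat \<Rightarrow> nat \<Rightarrow> bool" where
  "a_equals G i a \<longleftrightarrow>
     (\<forall>u \<in> verts G. \<forall>v \<in> verts G. gdist G u v = enat i \<longrightarrow> a_number G i u v = a)"

section \<open>Automorphisms and normal quotients\<close>

definition aut_group :: "'a sgraph \<Rightarrow> ('a \<Rightarrow> 'a) monoid" where
  "aut_group G = (BijGroup (verts G))
     \<lparr>carrier := {f \<in> Bij (verts G).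
        \<forall>x \<in> verts G. \<forall>y \<in> verts G. (f x, f y) \<in> adj G \<longleftrightarrow> (x, y) \<in> adj G}\<rparr>"

text \<open>Automorphisms act by evaluation, so the action map is \<open>\<lambda>k. k\<close>.\<close>

definition normal_quotient :: "'a sgraph \<Rightarrow> ('a \<Rightarrow> 'a) set \<Rightarrow> 'a set sgraph" where
  "normal_quotient G K =
     (let V = orbits ((aut_group G)\<lparr>carrier := K\<rparr>) (verts G) (\<lambda>k. k)
      in \<lparr>verts = V,
          adj = {(B, C). B \<in> V \<and> C \<in> V \<and> B \<noteq> C \<and> (\<exists>x \<in> B. \<exists>y \<in> C. (x, y) \<in> adj G)}\<rparr>)"

text \<open>The infimum of a nonempty set in \<^typ>\<open>enat\<close> is attained, hence is its minimum.\<close>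

definition min_displacement :: "'a sgraph \<Rightarrow> ('a \<Rightarrow> 'a) set \<Rightarrow> enat" where
  "min_displacement G K =
     (if K = {\<one>\<^bsub>aut_group G\<^esub>} then \<infinity>
      else Inf {gdist G x (k x) | x k. x \<in> verts G \<and> k \<in> K \<and> k \<noteq> \<one>\<^bsub>aut_group G\<^esub>})"

section \<open>The cube\<close>

text \<open>\<^typ>\<open>bit\<close> is the field with two elements. The vectors of length \<open>n\<close> are the functions on
  \<open>{..<n}\<close>, extended by \<^term>\<open>undefined\<close> outside that set.\<close>

definition cube :: "nat \<Rightarrow> (nat \<Rightarrow> bit) sgraph" where
  "cube n = \<lparr>verts = {..<n} \<rightarrow>\<^sub>E UNIV,
             adj = {(x, y). x \<in> {..<n} \<rightarrow>\<^sub>E UNIV \<and> y \<in> {..<n} \<rightarrow>\<^sub>E UNIV \<and>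
                            card {i \<in> {..<n}. x i \<noteq> y i} = 1}\<rparr>"

section \<open>Well-formedness\<close>

lemma simple_graph_cube: "simple_graph (cube n)"
  by unfold_locales (auto simp: cube_def sym_def irrefl_def eq_commute)

lemma simple_graph_normal_quotient:
  assumes "simple_graph G"
  shows "simple_graph (normal_quotient G K)"
proof -
  have "sym (adj G)" using assms by (rule simple_graph.adj_sym)
  show ?thesis
  proof
    show "sym (adj (normal_quotient G K))"
      using \<open>sym (adj G)\<close> unfolding sym_def normal_quotient_def Let_def by fastforce
  qed (auto simp: normal_quotient_def Let_def irrefl_def)
qed

lemma subgroup_automorphisms: "subgroup (carrier (aut_group G)) (BijGroup (verts G))"
proof -
  interpret B: group "BijGroup (verts G)" by (rule group_BijGroup)
  let ?V = "verts G" and ?A = "carrier (aut_group G)"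
  have A: "f \<in> ?A \<longleftrightarrow> f \<in> Bij ?V \<and> (\<forall>x \<in> ?V. \<forall>y \<in> ?V. (f x, f y) \<in> adj G \<longleftrightarrow> (x, y) \<in> adj G)" for f
    by (simp add: aut_group_def)
  have im: "f x \<in> ?V" if "f \<in> Bij ?V" "x \<in> ?V" for f x
    using that by (auto simp: Bij_def bij_betw_def)
  show ?thesis
  proof (rule B.subgroupI)
    show "?A \<subseteq> carrier (BijGroup ?V)" by (auto simp: A BijGroup_def)
    have "(\<lambda>x \<in> ?V. x) \<in> ?A" by (simp add: A id_Bij)
    then show "?A \<noteq> {}" by blast
  next
    fix f assume f: "f \<in> ?A"
    let ?g = "restrict (inv_into ?V f) ?V"
    have fB: "f \<in> Bij ?V" using f A by blast
    have gB: "?g \<in> Bij ?V" using fB by (rule restrict_inv_into_Bij)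
    have fg: "f (?g x) = x" if "x \<in> ?V" for x
      using fB that by (auto simp: Bij_def bij_betw_def f_inv_into_f)
    have "(?g x, ?g y) \<in> adj G \<longleftrightarrow> (x, y) \<in> adj G" if "x \<in> ?V" "y \<in> ?V" for x y
      using f A fg im[OF gB] that by metis
    then have "?g \<in> ?A" using gB by (simp add: A)
    then show "inv\<^bsub>BijGroup ?V\<^esub> f \<in> ?A" using fB by (simp add: inv_BijGroup)
  next
    fix f g assume "f \<in> ?A" "g \<in> ?A"
    then show "f \<otimes>\<^bsub>BijGroup ?V\<^esub> g \<in> ?A"
      by (simp add: A BijGroup_def compose_Bij compose_eq im)
  qed
qed

lemma group_aut_group: "group (aut_group G)"
proof -
  have "aut_group G = (BijGroup (verts G))\<lparr>carrier := carrier (aut_group G)\<rparr>"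
    by (simp add: aut_group_def)
  then show ?thesis
    using group.subgroup_imp_group[OF group_BijGroup subgroup_automorphisms] by metis
qed

end

theory Submission
  imports Defs
begin

text \<open>Distances in the quotient are minimal distances between points of the two orbits. If all
  non-identity elements of \<open>K\<close> move all points by at least \<open>m\<close>, then for points at distance \<open>d\<close> with
  \<open>d + j < m\<close> the orbits are at distance at most \<open>j\<close> only if \<open>d \<le> j\<close>: an element of \<open>K\<close> that
  brings them closer moves a point by at most \<open>d + j\<close>. So small balls of the quotient look like those
  of the cube, which gives its parameters. Conversely, valency \<open>n\<close> forces displacement at least \<open>3\<close>:
  an element with a fixed point fixes all neighbours of that point, hence all points, and
  displacement \<open>1\<close> or \<open>2\<close> makes a point and its neighbours meet fewer than \<open>n + 1\<close> orbits.
  From there the displacement is raised by one at a time, by looking at the middle of a geodesic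
  between two points of an orbit: \<open>a\<^sub>j = 0\<close> excludes displacement \<open>2 j + 1\<close> and \<open>c\<^sub>j = j\<close> excludes \<open>2 j\<close>.\<close>

section \<open>Distances in graphs\<close>

text \<open>In \<open>enat\<close> an infimum strictly below \<open>enat (Suc k)\<close> is undercut
  by a member of the set, so a bound on the distance yields a walk.\<close>

lemma gdist_le_iff: "gdist G u v \<le> enat k \<longleftrightarrow> (\<exists>j\<le>k. (u, v) \<in> adj G ^^ j)"
proof
  assume "gdist G u v \<le> enat k"
  then have "gdist G u v < enat (Suc k)"
    by (rule le_less_trans) simp
  then obtain j where "(u, v) \<in> adj G ^^ j" "enat j < enat (Suc k)"
    unfolding gdist_def by (auto simp: INF_less_iff)
  then show "\<exists>j\<le>k. (u, v) \<in> adj G ^^ j" by (auto simp: less_Suc_eq_le)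
next
  assume "\<exists>j\<le>k. (u, v) \<in> adj G ^^ j"
  then obtain j where "j \<le> k" "(u, v) \<in> adj G ^^ j" by blast
  then show "gdist G u v \<le> enat k"
    unfolding gdist_def by (intro INF_lower2[of j]) auto
qed

lemma gdist_eq_iff:
  "gdist G u v = enat k \<longleftrightarrow> gdist G u v \<le> enat k \<and> (\<forall>j<k. \<not> gdist G u v \<le> enat j)"
proof (cases "gdist G u v")
  case (enat d)
  then show ?thesis by (auto simp: not_le) (metis nat_neq_iff order.refl le_neq_implies_less)
qed auto

lemma gdist_eq_0_iff: "gdist G u v = 0 \<longleftrightarrow> u = v"
  using gdist_le_iff[of G u v 0] by (auto simp: zero_enat_def[symmetric])

lemma gdist_eq_1_iff:
  assumes "irrefl (adj G)"
  shows "gdist G u v = enat 1 \<longleftrightarrow> (u, v) \<in> adj G"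
proof -
  have "gdist G u v \<le> enat 1 \<longleftrightarrow> u = v \<or> (u, v) \<in> adj G"
    unfolding gdist_le_iff le_Suc_eq One_nat_def by auto
  moreover have "gdist G u v = enat 1 \<longleftrightarrow> gdist G u v \<le> enat 1 \<and> gdist G u v \<noteq> 0"
    by (cases "gdist G u v") (auto simp: zero_enat_def)
  ultimately show ?thesis
    using assms unfolding gdist_eq_0_iff irrefl_def by blast
qed

section \<open>Hamming distance\<close>

definition hdist :: "nat \<Rightarrow> (nat \<Rightarrow> bit) \<Rightarrow> (nat \<Rightarrow> bit) \<Rightarrow> nat" where
  "hdist n x y = card {i \<in> {..<n}. x i \<noteq> y i}"

definition flip :: "(nat \<Rightarrow> bit) \<Rightarrow> nat \<Rightarrow> nat \<Rightarrow> bit" where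
  "flip x i = x(i := x i + 1)"

lemma bit_neq_iff: "a \<noteq> b \<longleftrightarrow> a = b + 1" for a b :: bit
  by (cases a; cases b) auto

lemma flip_flip [simp]: "flip (flip x i) i = x"
  by (auto simp: flip_def)

lemma flip_eq_iff: "flip x i = flip x j \<longleftrightarrow> i = j"
  by (auto simp: flip_def fun_eq_iff)

lemma verts_cube: "verts (cube n) = {..<n} \<rightarrow>\<^sub>E UNIV"
  by (simp add: cube_def)

lemma flip_in_verts [simp]: "x \<in> verts (cube n) \<Longrightarrow> i < n \<Longrightarrow> flip x i \<in> verts (cube n)"
  by (auto simp: verts_cube flip_def PiE_def extensional_def)

lemma adj_cube_iff_hdist:
  "(x, y) \<in> adj (cube n) \<longleftrightarrow> x \<in> verts (cube n) \<and> y \<in> verts (cube n) \<and> hdist n x y = 1"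
  by (simp add: cube_def hdist_def)

lemma hdist_commute: "hdist n x y = hdist n y x"
  unfolding hdist_def by (simp add: eq_commute)

lemma hdist_refl [simp]: "hdist n x x = 0"
  by (simp add: hdist_def)

lemma hdist_triangle: "hdist n x z \<le> hdist n x y + hdist n y z"
proof -
  have "hdist n x z \<le> card ({i \<in> {..<n}. x i \<noteq> y i} \<union> {i \<in> {..<n}. y i \<noteq> z i})"
    unfolding hdist_def by (intro card_mono) auto
  also have "\<dots> \<le> hdist n x y + hdist n y z"
    unfolding hdist_def by (rule card_Un_le)
  finally show ?thesis .
qed

lemma hdist_eq_0_iff:
  assumes "x \<in> verts (cube n)" "y \<in> verts (cube n)"
  shows "hdist n x y = 0 \<longleftrightarrow> x = y"
proof
  assume "hdist n x y = 0"
  then have "x i = y i" if "i < n" for i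
    using that by (auto simp: hdist_def)
  then show "x = y"
    using assms by (intro PiE_ext[of x "{..<n}" "\<lambda>_. UNIV"]) (auto simp: verts_cube)
qed auto

lemma hdist_flip_neq:
  assumes "i < n" "x i \<noteq> y i"
  shows "hdist n x y = Suc (hdist n x (flip y i))"
proof -
  have "{j \<in> {..<n}. x j \<noteq> y j} = insert i {j \<in> {..<n}. x j \<noteq> flip y i j}"
    using assms by (auto simp: flip_def bit_neq_iff)
  moreover have "i \<notin> {j \<in> {..<n}. x j \<noteq> flip y i j}"
    using assms by (auto simp: flip_def bit_neq_iff)
  ultimately show ?thesis by (simp add: hdist_def)
qed

lemma hdist_flip_eq:
  assumes "i < n" "x i = y i"
  shows "hdist n x (flip y i) = Suc (hdist n x y)"
proof -
  have "x i \<noteq> flip y i i" using assms(2) by (simp add: flip_def)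
  then show ?thesis using hdist_flip_neq[of i n x "flip y i"] assms(1) by simp
qed

lemma hdist_flip_self: "i < n \<Longrightarrow> hdist n x (flip x i) = 1"
  by (simp add: hdist_flip_eq)

lemma hdist_Suc_flip:
  assumes "hdist n x y = Suc m"
  obtains i where "i < n" "x i \<noteq> y i" "hdist n x (flip y i) = m"
proof -
  have "{i \<in> {..<n}. x i \<noteq> y i} \<noteq> {}"
    using assms unfolding hdist_def by (metis card.empty nat.distinct(1))
  then obtain i where "i < n" "x i \<noteq> y i" by auto
  then show ?thesis using that hdist_flip_neq assms by auto
qed

section \<open>Edges of the cube as flips, and geodesics\<close>

lemma adj_cube_iff_flip:
  "(x, y) \<in> adj (cube n) \<longleftrightarrow> x \<in> verts (cube n) \<and> (\<exists>i<n. y = flip x i)"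
proof
  assume xy: "(x, y) \<in> adj (cube n)"
  then have "hdist n y x = 1" by (simp add: adj_cube_iff_hdist hdist_commute)
  then obtain i where i: "i < n" "hdist n y (flip x i) = 0"
    using hdist_Suc_flip[of n y x 0] by auto
  then have "y = flip x i"
    using xy hdist_eq_0_iff[of y n "flip x i"] by (simp add: adj_cube_iff_hdist)
  then show "x \<in> verts (cube n) \<and> (\<exists>i<n. y = flip x i)"
    using xy i by (auto simp: adj_cube_iff_hdist)
qed (auto simp: adj_cube_iff_hdist hdist_flip_self)

lemma hdist_split:
  assumes "hdist n x z = a + b" "z \<in> verts (cube n)"
  obtains y where "y \<in> verts (cube n)" "hdist n x y = a" "hdist n y z = b"
proof -
  have "\<exists>y\<in>verts (cube n). hdist n x y = a \<and> hdist n y z = b"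
    using assms
  proof (induction b arbitrary: z)
    case 0
    then show ?case by auto
  next
    case (Suc b)
    then obtain i where i: "i < n" "hdist n x (flip z i) = a + b"
      using hdist_Suc_flip[of n x z "a + b"] by auto
    then obtain y where y: "y \<in> verts (cube n)" "hdist n x y = a" "hdist n y (flip z i) = b"
      using Suc.IH[of "flip z i"] Suc.prems by auto
    have "hdist n y z \<le> Suc b"
      using hdist_triangle[of n y z "flip z i"] hdist_flip_self[OF i(1), of z] y
      by (simp add: hdist_commute)
    \<comment> \<open>The reverse bound: \<open>z\<close> lies \<open>a + Suc b\<close> from
      \<open>x\<close>, and \<open>y\<close> accounts for only \<open>a\<close> of it.\<close>
    moreover have "a + Suc b \<le> a + hdist n y z"
      using hdist_triangle[of n x z y] y Suc.prems by simp
    ultimately show ?case using y by auto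
  qed
  then show ?thesis using that by blast
qed

lemma relpow_adj_cube_hdist:
  assumes "(x, y) \<in> adj (cube n) ^^ j"
  shows "hdist n x y \<le> j"
  using assms
proof (induction j arbitrary: y)
  case (Suc j)
  then obtain z where "(x, z) \<in> adj (cube n) ^^ j" "(z, y) \<in> adj (cube n)" by auto
  then show ?case
    using Suc.IH[of z] hdist_triangle[of n x y z] by (simp add: adj_cube_iff_hdist)
qed auto

lemma hdist_relpow_adj_cube:
  assumes "x \<in> verts (cube n)" "y \<in> verts (cube n)"
  shows "(x, y) \<in> adj (cube n) ^^ hdist n x y"
  using assms(2)
proof (induction "hdist n x y" arbitrary: y)
  case 0
  then show ?case using assms(1) by (simp add: hdist_eq_0_iff)
next
  case (Suc m)
  obtain i where i: "i < n" "hdist n x (flip y i) = m"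
    using hdist_Suc_flip[of n x y m] Suc.hyps by metis
  have "(flip y i, y) \<in> adj (cube n)"
    unfolding adj_cube_iff_flip using i Suc.prems by (metis flip_flip flip_in_verts)
  moreover have "(x, flip y i) \<in> adj (cube n) ^^ m"
    using Suc.hyps(1)[of "flip y i"] i Suc.prems by simp
  ultimately show ?case using Suc.hyps(2) by (metis relpow_Suc_I)
qed

lemma gdist_cube:
  assumes "x \<in> verts (cube n)" "y \<in> verts (cube n)"
  shows "gdist (cube n) x y = enat (hdist n x y)"
  using hdist_relpow_adj_cube[OF assms] relpow_adj_cube_hdist[of x y _ n]
  unfolding gdist_eq_iff gdist_le_iff by (meson leD le_trans order.refl)

section \<open>Quotients of the cube\<close>

locale cube_quotient =
  fixes n :: nat and K :: "((nat \<Rightarrow> bit) \<Rightarrow> (nat \<Rightarrow> bit)) set"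
  assumes subgroup_K: "subgroup K (aut_group (cube n))"
begin

abbreviation V where "V \<equiv> verts (cube n)"

abbreviation Q where "Q \<equiv> normal_quotient (cube n) K"

abbreviation id_V where "id_V \<equiv> \<one>\<^bsub>aut_group (cube n)\<^esub>"

definition orb :: "(nat \<Rightarrow> bit) \<Rightarrow> (nat \<Rightarrow> bit) set" where
  "orb x = {k x | k. k \<in> K}"

text \<open>For trivial \<open>K\<close> this holds for every \<open>m\<close>, in accordance with
  d_K being infinite; \<open>displaces_iff\<close> makes the link to
  \<open>min_displacement\<close>.\<close>

definition displaces :: "nat \<Rightarrow> bool" where
  "displaces m \<longleftrightarrow> (\<forall>x\<in>V. \<forall>k\<in>K. k \<noteq> id_V \<longrightarrow> m \<le> hdist n x (k x))"

section \<open>The action of \<open>K\<close> and its orbits\<close>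

lemma K_Bij: "k \<in> K \<Longrightarrow> k \<in> Bij V"
  and K_adj: "k \<in> K \<Longrightarrow> x \<in> V \<Longrightarrow> y \<in> V \<Longrightarrow> (k x, k y) \<in> adj (cube n) \<longleftrightarrow> (x, y) \<in> adj (cube n)"
  using subgroup.subset[OF subgroup_K] by (auto simp: aut_group_def)

lemma K_closed [simp]: "k \<in> K \<Longrightarrow> x \<in> V \<Longrightarrow> k x \<in> V"
  using K_Bij[of k] by (auto simp: Bij_def bij_betw_def)

lemma id_V_apply: "x \<in> V \<Longrightarrow> id_V x = x"
  by (simp add: aut_group_def BijGroup_def)

text \<open>Elements of \<open>Bij V\<close> are \<open>undefined\<close> outside \<open>V\<close>,
  so agreement on \<open>V\<close> is equality.\<close>

lemma eq_id_V_iff: "k \<in> K \<Longrightarrow> k = id_V \<longleftrightarrow> (\<forall>x\<in>V. k x = x)"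
  using K_Bij[of k] by (auto simp: aut_group_def BijGroup_def Bij_def extensional_def)

lemma mult_apply:
  assumes "h \<in> K" "k \<in> K" "x \<in> V"
  shows "(h \<otimes>\<^bsub>aut_group (cube n)\<^esub> k) x = h (k x)"
  using assms K_Bij by (simp add: aut_group_def BijGroup_def compose_eq)

lemma K_mult:
  assumes "h \<in> K" "k \<in> K"
  obtains g where "g \<in> K" "\<And>x. x \<in> V \<Longrightarrow> g x = h (k x)"
  using that[of "h \<otimes>\<^bsub>aut_group (cube n)\<^esub> k"] mult_apply[OF assms]
    subgroup.m_closed[OF subgroup_K assms] by blast

lemma K_inverse:
  assumes "k \<in> K"
  obtains g where "g \<in> K" "\<And>x. x \<in> V \<Longrightarrow> g (k x) = x"
proof -
  let ?g = "inv\<^bsub>aut_group (cube n)\<^esub> k"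
  have "?g \<in> K"
    using subgroup.m_inv_closed[OF subgroup_K assms] .
  moreover have "?g \<otimes>\<^bsub>aut_group (cube n)\<^esub> k = id_V"
    using group.l_inv[OF group_aut_group] subgroup.subset[OF subgroup_K] assms by blast
  then have "?g (k x) = x" if "x \<in> V" for x
    using mult_apply[OF \<open>?g \<in> K\<close> assms that] id_V_apply[OF that] by simp
  ultimately show ?thesis using that by blast
qed

lemma orb_refl: "x \<in> V \<Longrightarrow> x \<in> orb x"
  using subgroup.one_closed[OF subgroup_K] id_V_apply[of x] unfolding orb_def
  by (metis (mono_tags, lifting) mem_Collect_eq)

lemma orb_apply:
  assumes "k \<in> K" "x \<in> V"
  shows "orb (k x) = orb x"
proof
  show "orb (k x) \<subseteq> orb x"
    using assms by (auto simp: orb_def) (metis K_mult)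
  obtain g where g: "g \<in> K" "g (k x) = x"
    using K_inverse assms by metis
  show "orb x \<subseteq> orb (k x)"
  proof
    fix z assume "z \<in> orb x"
    then obtain h where h: "h \<in> K" "z = h x" by (auto simp: orb_def)
    then obtain f where "f \<in> K" "f (k x) = h (g (k x))"
      using K_mult[OF h(1) g(1)] assms by (metis K_closed)
    then have "z = f (k x)" using h g by simp
    then show "z \<in> orb (k x)" using \<open>f \<in> K\<close> unfolding orb_def by blast
  qed
qed

lemma orb_eq_iff:
  assumes "x \<in> V" "y \<in> V"
  shows "orb x = orb y \<longleftrightarrow> (\<exists>k\<in>K. k x = y)"
proof
  assume "orb x = orb y"
  then have "y \<in> orb x" using orb_refl[OF assms(2)] by simp
  then show "\<exists>k\<in>K. k x = y" by (auto simp: orb_def)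
qed (use assms orb_apply in blast)

section \<open>Adjacency in the quotient\<close>

lemma verts_Q: "verts Q = orb ` V"
  by (auto simp: normal_quotient_def orbits_def orbit_def orb_def Let_def)

lemma orb_in_verts_Q [simp]: "x \<in> V \<Longrightarrow> orb x \<in> verts Q"
  by (simp add: verts_Q)

lemma adj_Q:
  "(B, C) \<in> adj Q \<longleftrightarrow>
     B \<in> verts Q \<and> C \<in> verts Q \<and> B \<noteq> C \<and> (\<exists>x\<in>B. \<exists>y\<in>C. (x, y) \<in> adj (cube n))"
  by (auto simp: normal_quotient_def Let_def)

text \<open>An edge between two orbits can be carried by an element of \<open>K\<close> to one
  starting at the chosen point \<open>x\<close>.\<close>

lemma adj_Q_orb:
  assumes "x \<in> V"
  shows "(orb x, C) \<in> adj Q \<longleftrightarrow> (\<exists>i<n. C = orb (flip x i) \<and> C \<noteq> orb x)"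
proof
  assume "(orb x, C) \<in> adj Q"
  then obtain y a b where C: "y \<in> V" "C = orb y" "C \<noteq> orb x"
    and "a \<in> orb x" "b \<in> orb y" "(a, b) \<in> adj (cube n)"
    unfolding adj_Q verts_Q by auto
  moreover then obtain k h where k: "k \<in> K" "a = k x" and "h \<in> K" "b = h y"
    unfolding orb_def by auto
  moreover obtain g where g: "g \<in> K" "\<And>z. z \<in> V \<Longrightarrow> g (k z) = z"
    using K_inverse[OF k(1)] by blast
  ultimately have "(x, g b) \<in> adj (cube n)" and "orb (g b) = C"
    using K_adj[OF g(1), of a b] assms by (auto simp: orb_apply)
  then show "\<exists>i<n. C = orb (flip x i) \<and> C \<noteq> orb x"
    using C by (auto simp: adj_cube_iff_flip)
next
  assume "\<exists>i<n. C = orb (flip x i) \<and> C \<noteq> orb x"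
  then obtain i where "i < n" "C = orb (flip x i)" "C \<noteq> orb x" by blast
  moreover from this have "(x, flip x i) \<in> adj (cube n)"
    using assms by (auto simp: adj_cube_iff_flip)
  ultimately show "(orb x, C) \<in> adj Q"
    unfolding adj_Q using assms orb_refl[OF assms] orb_refl[of "flip x i"] by auto
qed

lemma irrefl_adj_Q: "irrefl (adj Q)"
  using simple_graph_normal_quotient[OF simple_graph_cube] by (rule simple_graph.adj_irrefl)

lemma sphere_at_Q_1:
  assumes "x \<in> V"
  shows "sphere_at Q 1 (orb x) = (\<lambda>i. orb (flip x i)) ` {i. i < n \<and> orb (flip x i) \<noteq> orb x}"
  using assms
  by (auto simp: sphere_at_def gdist_eq_1_iff[OF irrefl_adj_Q, unfolded One_nat_def] adj_Q_orb)

section \<open>Distances between orbits\<close>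

lemma relpow_adj_Q_lift:
  assumes "(orb x, C) \<in> adj Q ^^ j" "x \<in> V"
  shows "\<exists>y\<in>V. C = orb y \<and> hdist n x y \<le> j"
  using assms(1)
proof (induction j arbitrary: C)
  case 0
  then show ?case using assms(2) by auto
next
  case (Suc j)
  then obtain B where "(orb x, B) \<in> adj Q ^^ j" "(B, C) \<in> adj Q" by auto
  then obtain z where z: "z \<in> V" "B = orb z" "hdist n x z \<le> j" using Suc.IH by blast
  with \<open>(B, C) \<in> adj Q\<close> obtain i where i: "i < n" "C = orb (flip z i)"
    using adj_Q_orb by blast
  then have "hdist n x (flip z i) \<le> Suc j"
    using hdist_triangle[of n x "flip z i" z] hdist_flip_self[OF i(1), of z] z by simp
  then show ?case using i z by (metis flip_in_verts)
qed

text \<open>A step inside one orbit disappears in the quotient, hence a walk of length at most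
  \<open>j\<close> instead of exactly \<open>j\<close>.\<close>

lemma relpow_adj_cube_project:
  assumes "(x, y) \<in> adj (cube n) ^^ j" "x \<in> V"
  shows "\<exists>i\<le>j. (orb x, orb y) \<in> adj Q ^^ i"
  using assms(1)
proof (induction j arbitrary: y)
  case (Suc j)
  then obtain z where z: "(x, z) \<in> adj (cube n) ^^ j" "(z, y) \<in> adj (cube n)" by auto
  then obtain i where i: "i \<le> j" "(orb x, orb z) \<in> adj Q ^^ i" using Suc.IH by blast
  show ?case
  proof (cases "orb y = orb z")
    case True
    then show ?thesis using i by (metis le_SucI)
  next
    case False
    then have "(orb z, orb y) \<in> adj Q"
      using z(2) adj_Q_orb by (auto simp: adj_cube_iff_flip)
    then show ?thesis using i by (metis relpow_Suc_I Suc_le_mono)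
  qed
qed auto

text \<open>Walks of the quotient lift to the cube from any starting point and walks of the cube
  project, so the distance of two orbits is the least distance from \<open>x\<close> to a point of
  the other orbit.\<close>

lemma gdist_Q_le_iff:
  assumes "x \<in> V" "y \<in> V"
  shows "gdist Q (orb x) (orb y) \<le> enat j \<longleftrightarrow> (\<exists>k\<in>K. hdist n x (k y) \<le> j)"
proof
  assume "gdist Q (orb x) (orb y) \<le> enat j"
  then obtain i where i: "i \<le> j" "(orb x, orb y) \<in> adj Q ^^ i"
    unfolding gdist_le_iff by blast
  then obtain z where z: "z \<in> V" "orb y = orb z" "hdist n x z \<le> i"
    using relpow_adj_Q_lift assms by blast
  then obtain k where "k \<in> K" "k y = z"
    using orb_eq_iff[OF assms(2)] by blast
  then show "\<exists>k\<in>K. hdist n x (k y) \<le> j"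
    using z(3) i(1) by (intro bexI[of _ k]) simp_all
next
  assume "\<exists>k\<in>K. hdist n x (k y) \<le> j"
  then obtain k where k: "k \<in> K" "hdist n x (k y) \<le> j" by blast
  then show "gdist Q (orb x) (orb y) \<le> enat j"
    using relpow_adj_cube_project[OF hdist_relpow_adj_cube[of x n "k y"]] assms
    by (auto simp: orb_apply gdist_le_iff intro: le_trans)
qed

lemma gdist_Q_le_hdist:
  "x \<in> V \<Longrightarrow> y \<in> V \<Longrightarrow> gdist Q (orb x) (orb y) \<le> enat (hdist n x y)"
  using gdist_Q_le_iff[of x y "hdist n x y"] id_V_apply subgroup.one_closed[OF subgroup_K]
  by (metis order.refl)

lemma gdist_Q_attained:
  assumes "x \<in> V" "C \<in> verts Q" "gdist Q (orb x) C = enat j"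
  obtains y where "y \<in> V" "C = orb y" "hdist n x y = j"
proof -
  obtain z where z: "z \<in> V" "C = orb z" using assms(2) by (auto simp: verts_Q)
  then obtain k where k: "k \<in> K" "hdist n x (k z) \<le> j"
    using gdist_Q_le_iff[of x z j] assms by auto
  then have "enat j \<le> enat (hdist n x (k z))"
    using gdist_Q_le_hdist[of x "k z"] z assms by (simp add: orb_apply)
  then show ?thesis using that[of "k z"] k z by (simp add: orb_apply)
qed

section \<open>Local agreement of the quotient with the cube\<close>

lemma displacesD:
  assumes "displaces m" "x \<in> V" "k \<in> K" "hdist n x (k x) < m" "z \<in> V"
  shows "k z = z"
  using assms id_V_apply unfolding displaces_def by (metis leD)

lemma gdist_Q_le_iff_local:
  assumes "displaces m" "x \<in> V" "y \<in> V" "hdist n x y + j < m"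
  shows "gdist Q (orb x) (orb y) \<le> enat j \<longleftrightarrow> hdist n x y \<le> j"
proof
  assume "gdist Q (orb x) (orb y) \<le> enat j"
  then obtain k where k: "k \<in> K" "hdist n x (k y) \<le> j"
    using gdist_Q_le_iff assms by blast
  \<comment> \<open>As \<open>k\<close> brings \<open>y\<close> within \<open>j\<close> of
    \<open>x\<close>, it moves \<open>y\<close> by at most \<open>hdist n x y + j\<close>; being
    below \<open>m\<close>, this makes \<open>k\<close> trivial.\<close>
  have "hdist n y (k y) < m"
    using hdist_triangle[of n y "k y" x] k assms(4) by (simp add: hdist_commute)
  then show "hdist n x y \<le> j"
    using displacesD[OF assms(1,3) k(1)] assms(3) k(2) by simp
next
  assume "hdist n x y \<le> j"
  then show "gdist Q (orb x) (orb y) \<le> enat j"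
    using gdist_Q_le_hdist[OF assms(2,3)] by (meson enat_ord_simps(1) order_trans)
qed

text \<open>Only \<open>j < hdist n x y\<close> has to be ruled out, and then
  \<open>hdist n x y + j\<close> is below twice the distance. The extremal case
  \<open>2 * hdist n x y = m\<close> is the one used in \<open>displaces_step_even\<close>.\<close>

lemma gdist_Q_eq_hdist:
  assumes "displaces m" "x \<in> V" "y \<in> V" "2 * hdist n x y \<le> m"
  shows "gdist Q (orb x) (orb y) = enat (hdist n x y)"
  unfolding gdist_eq_iff
proof (intro conjI allI impI)
  fix j assume "j < hdist n x y"
  then show "\<not> gdist Q (orb x) (orb y) \<le> enat j"
    using gdist_Q_le_iff_local[OF assms(1-3), of j] assms(4) by simp
qed (rule gdist_Q_le_hdist[OF assms(2,3)])

lemma displaces_iff: "enat m \<le> min_displacement (cube n) K \<longleftrightarrow> displaces m"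
proof (cases "K = {id_V}")
  case True
  then show ?thesis unfolding displaces_def by (auto simp: min_displacement_def)
next
  case False
  have "enat m \<le> min_displacement (cube n) K \<longleftrightarrow>
      (\<forall>x\<in>V. \<forall>k\<in>K. k \<noteq> id_V \<longrightarrow> enat m \<le> gdist (cube n) x (k x))"
    using False by (auto simp: min_displacement_def le_Inf_iff)
  also have "\<dots> \<longleftrightarrow> displaces m"
    by (auto simp: displaces_def gdist_cube)
  finally show ?thesis .
qed

section \<open>From displacement to the parameters of the quotient\<close>

text \<open>A vertex and its neighbours are pairwise at distance at most 2, too close to share an
  orbit when points move by at least 3.\<close>

lemma displaces_3_neighbours:
  assumes "displaces m" "3 \<le> m" "x \<in> V"
  shows "inj_on (\<lambda>i. orb (flip x i)) {..<n}" and "i < n \<Longrightarrow> orb (flip x i) \<noteq> orb x"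
proof -
  show "inj_on (\<lambda>i. orb (flip x i)) {..<n}"
  proof (rule inj_onI)
    fix i j assume ij: "i \<in> {..<n}" "j \<in> {..<n}" "orb (flip x i) = orb (flip x j)"
    then obtain k where k: "k \<in> K" "k (flip x i) = flip x j"
      using orb_eq_iff[of "flip x i" "flip x j"] assms(3) by auto
    have "hdist n (flip x i) (flip x j) \<le> 2"
      using hdist_triangle[of n "flip x i" "flip x j" x] ij hdist_flip_self
      by (simp add: hdist_commute)
    then have "flip x j = flip x i"
      using displacesD[OF assms(1) _ k(1), of "flip x i" "flip x i"] k assms ij by simp
    then show "i = j" by (simp add: flip_eq_iff)
  qed
  show "orb (flip x i) \<noteq> orb x" if i: "i < n"
  proof
    assume "orb (flip x i) = orb x"
    then obtain k where k: "k \<in> K" "k x = flip x i"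
      using orb_eq_iff[of x "flip x i"] assms(3) flip_in_verts[OF assms(3) i] by auto
    then have "flip x i = x"
      using displacesD[OF assms(1,3) k(1) _ assms(3)] assms hdist_flip_self[OF i, of x] by simp
    then show False using hdist_flip_self[OF i, of x] by simp
  qed
qed

lemma displaces_sphere_1:
  assumes "displaces m" "3 \<le> m" "x \<in> V"
  shows "sphere_at Q 1 (orb x) = (\<lambda>i. orb (flip x i)) ` {..<n}"
  unfolding sphere_at_Q_1[OF assms(3)] using displaces_3_neighbours(2)[OF assms] by auto

lemma displaces_regular:
  assumes "displaces m" "3 \<le> m"
  shows "regular_of_valency Q n"
  using displaces_sphere_1[OF assms] displaces_3_neighbours(1)[OF assms]
  by (auto simp: regular_of_valency_def verts_Q card_image)

text \<open>Parity: a flip of \<open>y\<close> changes its distance to \<open>x\<close> by exactly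
  one, and distances up to \<open>j + 1\<close> survive in the quotient because
  \<open>2 * (j + 1) <= m\<close>.\<close>

lemma displaces_a_equals:
  assumes "displaces m" "2 * j + 3 \<le> m"
  shows "a_equals Q j 0"
  unfolding a_equals_def
proof (intro ballI impI)
  fix B C assume "B \<in> verts Q" and C: "C \<in> verts Q" "gdist Q B C = enat j"
  then obtain x where x: "x \<in> V" "B = orb x" by (auto simp: verts_Q)
  obtain y where y: "y \<in> V" "C = orb y" "hdist n x y = j"
    using gdist_Q_attained[OF x(1)] C x by blast
  have "gdist Q (orb x) (orb (flip y i)) \<noteq> enat j" if i: "i < n" for i
  proof (cases "x i = y i")
    case True
    then show ?thesis
      using hdist_flip_eq[of i n x y] gdist_Q_eq_hdist[OF assms(1), of x "flip y i"] assms(2) i x y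
      by auto
  next
    case False
    then show ?thesis
      using hdist_flip_neq[of i n x y] gdist_Q_eq_hdist[OF assms(1), of x "flip y i"] assms(2) i x y
      by auto
  qed
  then have "sphere_at Q j B \<inter> sphere_at Q 1 C = {}"
    using displaces_sphere_1[OF assms(1) _ y(1)] assms(2) x y by (auto simp: sphere_at_def)
  then show "a_number Q j B C = 0" by (simp add: a_number_def)
qed

lemma displaces_c_equals:
  assumes "displaces m" "1 \<le> j" "2 * j + 1 \<le> m"
  shows "c_equals Q j j"
  unfolding c_equals_def
proof (intro ballI impI)
  fix B C assume "B \<in> verts Q" and C: "C \<in> verts Q" "gdist Q B C = enat j"
  then obtain x where x: "x \<in> V" "B = orb x" by (auto simp: verts_Q)
  obtain y where y: "y \<in> V" "C = orb y" "hdist n x y = j"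
    using gdist_Q_attained[OF x(1)] C x by blast
  have "gdist Q (orb x) (orb (flip y i)) = enat (j - 1) \<longleftrightarrow> x i \<noteq> y i" if i: "i < n" for i
  proof (cases "x i = y i")
    case True
    then have "hdist n x (flip y i) = Suc j"
      using hdist_flip_eq[of i n x y] i y by auto
    \<comment> \<open>At \<open>m = 2 * j + 1\<close> the distance \<open>j + 1\<close> is too large
      for \<open>gdist_Q_eq_hdist\<close>; excluding \<open>j - 1\<close> suffices, and
      \<open>(j + 1) + (j - 1) < m\<close>.\<close>
    then have "\<not> gdist Q (orb x) (orb (flip y i)) \<le> enat (j - 1)"
      using gdist_Q_le_iff_local[OF assms(1), of x "flip y i" "j - 1"] assms(2,3) x y i by simp
    then show ?thesis using True by auto
  next
    case False
    then have "hdist n x (flip y i) = j - 1"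
      using hdist_flip_neq[of i n x y] i y by auto
    then show ?thesis
      using False gdist_Q_eq_hdist[OF assms(1), of x "flip y i"] assms(3) i x y by simp
  qed
  then have "sphere_at Q (j - 1) B \<inter> sphere_at Q 1 C
      = (\<lambda>i. orb (flip y i)) ` {i \<in> {..<n}. x i \<noteq> y i}"
    using displaces_sphere_1[OF assms(1) _ y(1)] assms(2,3) x y by (auto simp: sphere_at_def)
  moreover have "inj_on (\<lambda>i. orb (flip y i)) {i \<in> {..<n}. x i \<noteq> y i}"
    using displaces_3_neighbours(1)[OF assms(1) _ y(1)] assms(2,3)
    by (auto intro: inj_on_subset)
  ultimately show "c_number Q j B C = j"
    using y by (simp add: c_number_def card_image hdist_def)
qed

section \<open>From the parameters of the quotient to displacement\<close>

text \<open>There are only \<open>n\<close> flips, so valency \<open>n\<close> leaves no room for a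
  flip that stays in the orbit of \<open>x\<close> or for two flips in the same orbit.\<close>

lemma regular_neighbours:
  assumes "regular_of_valency Q n" "x \<in> V"
  shows "inj_on (\<lambda>i. orb (flip x i)) {..<n}" and "i < n \<Longrightarrow> orb (flip x i) \<noteq> orb x"
proof -
  let ?I = "{i. i < n \<and> orb (flip x i) \<noteq> orb x}"
  have n: "card ((\<lambda>i. orb (flip x i)) ` ?I) = n"
    using assms unfolding sphere_at_Q_1[OF assms(2), symmetric] regular_of_valency_def by simp
  moreover have "card ((\<lambda>i. orb (flip x i)) ` ?I) \<le> card ?I" by (rule card_image_le) auto
  ultimately have "?I = {..<n}"
    by (intro card_subset_eq) (auto intro!: antisym card_mono[of "{..<n}" ?I, simplified])
  with n show "inj_on (\<lambda>i. orb (flip x i)) {..<n}"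
    by (intro eq_card_imp_inj_on) auto
  show "orb (flip x i) \<noteq> orb x" if "i < n"
    using that \<open>?I = {..<n}\<close> by blast
qed

text \<open>Fixedness spreads along edges: if \<open>k\<close> fixes a vertex, it permutes the
  neighbours of that vertex and keeps each in its orbit, and these orbits are distinct.\<close>

lemma regular_fixed_point:
  assumes "regular_of_valency Q n" "x \<in> V" "k \<in> K" "k x = x" "z \<in> V"
  shows "k z = z"
  using assms(5)
proof (induction "hdist n x z" arbitrary: z)
  case 0
  then show ?case using assms by (metis hdist_eq_0_iff)
next
  case (Suc m)
  obtain i where i: "i < n" "hdist n x (flip z i) = m"
    using hdist_Suc_flip[of n x z m] Suc.hyps by metis
  let ?y = "flip z i"
  have y: "?y \<in> V" "k ?y = ?y" using Suc i by auto
  have "(?y, z) \<in> adj (cube n)" using i y by (metis adj_cube_iff_flip flip_flip)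
  then have "(?y, k z) \<in> adj (cube n)"
    using K_adj[OF assms(3) y(1) Suc.prems] y(2) by simp
  then obtain j where j: "j < n" "k z = flip ?y j" by (auto simp: adj_cube_iff_flip)
  then have "orb (flip ?y j) = orb (flip ?y i)"
    using orb_apply[OF assms(3) Suc.prems] by simp
  then have "j = i"
    using inj_onD[OF regular_neighbours(1)[OF assms(1) y(1)]] i(1) j(1) by blast
  then show ?case using j by simp
qed

text \<open>Displacement 0 is excluded by \<open>regular_fixed_point\<close>, displacement 1 because
  adjacent points lie in distinct orbits, displacement 2 because both ends are neighbours of a
  midpoint.\<close>

lemma regular_displaces_3:
  assumes "regular_of_valency Q n"
  shows "displaces 3"
  unfolding displaces_def
proof (intro ballI impI)
  fix x k assume x: "x \<in> V" and k: "k \<in> K" "k \<noteq> id_V"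
  have "k x \<noteq> x"
    using regular_fixed_point[OF assms x k(1)] eq_id_V_iff[OF k(1)] k(2) by blast
  then have "hdist n x (k x) \<noteq> 0" using x k by (simp add: hdist_eq_0_iff)
  moreover have "hdist n x (k x) \<noteq> 1"
  proof
    assume "hdist n x (k x) = 1"
    then obtain i where "i < n" "k x = flip x i"
      using adj_cube_iff_hdist[of x "k x" n] adj_cube_iff_flip[of x "k x" n] x k by auto
    then show False
      using regular_neighbours(2)[OF assms x] orb_apply[OF k(1) x] by metis
  qed
  moreover have "hdist n x (k x) \<noteq> 2"
  proof
    assume "hdist n x (k x) = 2"
    then obtain y where y: "y \<in> V" "hdist n x y = 1" "hdist n y (k x) = 1"
      using hdist_split[of n x "k x" 1 1] x k by auto
    have "(y, x) \<in> adj (cube n)" "(y, k x) \<in> adj (cube n)"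
      using y x k by (auto simp: adj_cube_iff_hdist hdist_commute)
    then obtain i j where ij: "i < n" "x = flip y i" "j < n" "k x = flip y j"
      by (auto simp: adj_cube_iff_flip)
    then have "orb (flip y i) = orb (flip y j)" using orb_apply[OF k(1) x] by simp
    then have "i = j" using regular_neighbours(1)[OF assms y(1)] ij by (auto dest: inj_onD)
    then show False using ij \<open>k x \<noteq> x\<close> by simp
  qed
  ultimately show "3 \<le> hdist n x (k x)" by linarith
qed

section \<open>Raising the displacement by one\<close>

lemma orb_flip_in_sphere_1:
  assumes "regular_of_valency Q n" "x \<in> V" "i < n"
  shows "orb (flip x i) \<in> sphere_at Q 1 (orb x)"
  unfolding sphere_at_Q_1[OF assms(2)] using assms(3) regular_neighbours(2)[OF assms(1,2)] by blast

text \<open>If \<open>x\<close> and \<open>k x\<close> are \<open>2 * j + 1\<close> apart, the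
  middle edge of a geodesic has one end at distance \<open>j\<close> from \<open>x\<close> and the
  other at distance \<open>j\<close> from \<open>k x\<close>. The two ends give adjacent orbits,
  both at distance \<open>j\<close> from the orbit of \<open>x\<close>, against a_j = 0.\<close>

lemma displaces_step_odd:
  assumes reg: "regular_of_valency Q n" and a: "a_equals Q j 0" and D: "displaces (2 * j + 1)"
  shows "displaces (2 * j + 2)"
  unfolding displaces_def
proof (intro ballI impI)
  fix x k assume x: "x \<in> V" and k: "k \<in> K" "k \<noteq> id_V"
  have "2 * j + 1 \<le> hdist n x (k x)" using D x k by (auto simp: displaces_def)
  moreover have "hdist n x (k x) \<noteq> 2 * j + 1"
  proof
    assume "hdist n x (k x) = 2 * j + 1"
    then obtain y where y: "y \<in> V" "hdist n x y = j" "hdist n y (k x) = Suc j"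
      using hdist_split[of n x "k x" j "Suc j"] x k by auto
    then obtain i where i: "i < n" "hdist n (k x) (flip y i) = j"
      using hdist_Suc_flip[of n "k x" y j] by (metis hdist_commute)
    have dy: "gdist Q (orb x) (orb y) = enat j"
      using gdist_Q_eq_hdist[OF D x y(1)] y by simp
    \<comment> \<open>Measured from \<open>k x\<close>, another representative of the orbit of
      \<open>x\<close>.\<close>
    have "gdist Q (orb x) (orb (flip y i)) = enat j"
      using gdist_Q_eq_hdist[OF D, of "k x" "flip y i"] i x y k by (simp add: orb_apply)
    then have "orb (flip y i) \<in> sphere_at Q j (orb x) \<inter> sphere_at Q 1 (orb y)"
      using orb_flip_in_sphere_1[OF reg y(1) i(1)] y i by (simp add: sphere_at_def)
    \<comment> \<open>As \<open>card\<close> is 0 on infinite sets, finiteness lets a nonempty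
      intersection count as nonzero.\<close>
    moreover have "finite (sphere_at Q 1 (orb y))"
      using reg y by (simp add: regular_of_valency_def)
    ultimately have "a_number Q j (orb x) (orb y) \<noteq> 0"
      unfolding a_number_def by (metis card_0_eq empty_iff finite_Int)
    then show False using a dy x y by (simp add: a_equals_def)
  qed
  ultimately show "2 * j + 2 \<le> hdist n x (k x)" by linarith
qed

text \<open>If an orbit has two points at even distance \<open>2 j\<close>, the midpoint of a geodesic has \<open>j\<close>
  neighbours closer to the first point and a further one closer to the second.\<close>

lemma displaces_step_even:
  assumes reg: "regular_of_valency Q n" and c: "c_equals Q j j" and D: "displaces (2 * j)"
    and "1 \<le> j"
  shows "displaces (2 * j + 1)"
  unfolding displaces_def
proof (intro ballI impI)
  fix x k assume x: "x \<in> V" and k: "k \<in> K" "k \<noteq> id_V"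
  have "2 * j \<le> hdist n x (k x)" using D x k by (auto simp: displaces_def)
  moreover have "hdist n x (k x) \<noteq> 2 * j"
  proof
    assume xk: "hdist n x (k x) = 2 * j"
    then obtain y where y: "y \<in> V" "hdist n x y = j" "hdist n y (k x) = j"
      using hdist_split[of n x "k x" j j] x k by auto
    then obtain p where p: "p < n" "hdist n (k x) (flip y p) = j - 1"
      using hdist_Suc_flip[of n "k x" y "j - 1"] \<open>1 \<le> j\<close>
      by (metis hdist_commute Suc_diff_1 less_eq_Suc_le One_nat_def)
    let ?I = "{i \<in> {..<n}. x i \<noteq> y i}"
    have closer: "hdist n x (flip y i) = j - 1" if "i \<in> ?I" for i
      using hdist_flip_neq[of i n x y] that y by simp
    \<comment> \<open>A point at distance \<open>j - 1\<close> from both \<open>x\<close> and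
      \<open>k x\<close> would bring these within \<open>2 * j - 2\<close>.\<close>
    have "p \<notin> ?I"
    proof
      assume "p \<in> ?I"
      then have "2 * j \<le> (j - 1) + (j - 1)"
        using hdist_triangle[of n x "k x" "flip y p"] closer[of p] p xk
        by (simp add: hdist_commute)
      then show False using \<open>1 \<le> j\<close> by simp
    qed
    have "gdist Q (orb x) (orb (flip y p)) = enat (j - 1)"
      using gdist_Q_eq_hdist[OF D, of "k x" "flip y p"] p x y k by (simp add: orb_apply)
    moreover have "gdist Q (orb x) (orb (flip y i)) = enat (j - 1)" if "i \<in> ?I" for i
      using gdist_Q_eq_hdist[OF D x, of "flip y i"] closer[OF that] y that by simp
    ultimately have "(\<lambda>i. orb (flip y i)) ` insert p ?I
        \<subseteq> sphere_at Q (j - 1) (orb x) \<inter> sphere_at Q 1 (orb y)"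
      using orb_flip_in_sphere_1[OF reg y(1)] p y by (auto simp: sphere_at_def)
    moreover have "finite (sphere_at Q 1 (orb y))"
      using reg y by (simp add: regular_of_valency_def)
    ultimately have "card ((\<lambda>i. orb (flip y i)) ` insert p ?I) \<le> c_number Q j (orb x) (orb y)"
      unfolding c_number_def by (intro card_mono) auto
    \<comment> \<open>Regularity puts these \<open>Suc j\<close> neighbours into distinct orbits,
      one more than c_j = j allows.\<close>
    moreover have "inj_on (\<lambda>i. orb (flip y i)) (insert p ?I)"
      using regular_neighbours(1)[OF reg y(1)] by (rule inj_on_subset) (use p in auto)
    then have "card ((\<lambda>i. orb (flip y i)) ` insert p ?I) = Suc j"
      using \<open>p \<notin> ?I\<close> y(2) by (simp add: card_image hdist_def)
    moreover have "gdist Q (orb x) (orb y) = enat j"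
      using gdist_Q_eq_hdist[OF D x y(1)] y by simp
    then have "c_number Q j (orb x) (orb y) = j"
      using c x y by (simp add: c_equals_def)
    ultimately show False by simp
  qed
  ultimately show "2 * j + 1 \<le> hdist n x (k x)" by linarith
qed

text \<open>Induction on \<open>l\<close>: valency \<open>n\<close> gives the start 3, then a_l = 0
  raises \<open>2 * l + 1\<close> to \<open>2 * l + 2\<close>, and c_{l+1} = l + 1 raises that to
  \<open>2 * l + 3\<close>.\<close>

lemma parameters_displaces:
  assumes "regular_of_valency Q n" "1 \<le> l"
    and "\<And>i. 1 \<le> i \<Longrightarrow> i \<le> l \<Longrightarrow> a_equals Q (i - 1) 0 \<and> c_equals Q i i"
  shows "displaces (2 * l + 1)"
  using assms(2,3)
proof (induction l rule: dec_induct)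
  case base
  show ?case using regular_displaces_3[OF assms(1)] by simp
next
  case (step l)
  have "displaces (2 * l + 2)"
    using displaces_step_odd[OF assms(1)] step.IH step.prems[of "Suc l"] step.prems step.hyps by simp
  then show ?case
    using displaces_step_even[OF assms(1), of "Suc l"] step.prems[of "Suc l"] by simp
qed

end

theorem theorem1p2:
  fixes n l :: nat and K :: "((nat \<Rightarrow> bit) \<Rightarrow> (nat \<Rightarrow> bit)) set"
  assumes "subgroup K (aut_group (cube n))"
    and "l \<ge> 1"
  shows "(regular_of_valency (normal_quotient (cube n) K) n \<and>
          (\<forall>i \<in> {1..l}. a_equals (normal_quotient (cube n) K) (i - 1) 0 \<and>
                         c_equals (normal_quotient (cube n) K) i i))
         \<longleftrightarrow> min_displacement (cube n) K \<ge> enat (2 * l + 1)"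
proof -
  interpret cube_quotient n K using assms(1) by (rule cube_quotient.intro)
  show ?thesis
    unfolding displaces_iff
  proof
    assume "regular_of_valency Q n \<and>
      (\<forall>i\<in>{1..l}. a_equals Q (i - 1) 0 \<and> c_equals Q i i)"
    then show "displaces (2 * l + 1)"
      using assms(2) by (intro parameters_displaces) auto
  next
    assume D: "displaces (2 * l + 1)"
    show "regular_of_valency Q n \<and>
      (\<forall>i\<in>{1..l}. a_equals Q (i - 1) 0 \<and> c_equals Q i i)"
      \<comment> \<open>Since \<open>1 <= l\<close>, the displacement is at least 3; for
        \<open>1 <= i <= l\<close> both \<open>2 * (i - 1) + 3\<close> and \<open>2 * i + 1\<close>
        are at most \<open>2 * l + 1\<close>.\<close>
      using displaces_regular[OF D] displaces_a_equals[OF D] displaces_c_equals[OF D] assms(2)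
      by auto
  qed
qed

end
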